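(* Consider the system with constant state and input delays $$\dot x(t)=Ax(t)+\sum_{i=1}^{m_x}a_iA_dx(t-\tau_i)+\sum_{j=1}^{m_u}B_ju(t-\delta_j),\qquad y(t)=Cx(t),$$ where $x(t)\in\mathbb{R}^n$, $y(t)\in\mathbb{R}^{n_y}$, $A,A_d\in\mathbb{R}^{n\times n}$, $C\in\mathbb{R}^{n_y\times n}$, $u$ is the input, $B_j$ ($j=1,\dots,m_u$) are real matrices of appropriate dimensions, $a_i\in\mathbb{R}$, $\tau_i>0$ ($i=1,\dots,m_x$) and $\delta_j\ge0$ ($j=1,\dots,m_u$). Consider the cubic observer $$\dot w_c(t)=Gw_c(t)+Jy(t)+\sum_{i=1}^{m_x}J_iy(t-\tau_i)+\sum_{j=1}^{m_u}H_ju(t-\delta_j)-\big(e_c^T(t)C^T\theta Ce_c(t)\big)NCe_c(t),\qquad \hat x(t)=w_c(t)+Ey(t),$$ where $e_c(t)=x(t)-\hat x(t)$, $G\in\mathbb{R}^{n\times n}$, $J,J_i,E,N\in\mathbb{R}^{n\times n_y}$, $H_j$ has the same size as $B_j$, and $\theta=\theta^T\ge0$ in $\mathbb{R}^{n_y\times n_y}$. Suppose that (i) there is no vector $v\in\mathbb{R}^n$, $v\ne0$, with $Gv+(v^TC^T\theta Cv)NCv=0$; (ii) there exists $P=P^T>0$ in $\mathbb{R}^{n\times n}$ such that $G^TP+PG<0$ and $PNC+C^TN^TP<0$; (iii) $G(I-EC)+JC-(I-EC)A=0$; (iv) $(I-EC)B_j-H_j=0$ for $j=1,\dots,m_u$;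 (v) $(I-EC)a_iA_d-J_iC=0$ for $i=1,\dots,m_x$. Then the estimation error dynamics (the dynamics of $e_c$) is globally stable.
   Context: Matrix inequalities such as $M>0$, $M\ge 0$, $M<0$ are in the sense of (semi)definiteness of symmetric matrices. The term "globally stable" is used without a further definition; the result is presented as a convergence criterion for the observer. *)

theory Defs
  imports "HOL-Analysis.Analysis"
begin

definition pos_semidef_mat :: "real^'n^'n \<Rightarrow> bool" where
  "pos_semidef_mat M \<longleftrightarrow> transpose M = M \<and> (\<forall>v. v \<bullet> (M *v v) \<ge> 0)"

definition pos_def_mat :: "real^'n^'n \<Rightarrow> bool" where
  "pos_def_mat M \<longleftrightarrow> transpose M = M \<and> (\<forall>v. v \<noteq> 0 \<longrightarrow> v \<bullet> (M *v v) > 0)"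

definition neg_def_mat :: "real^'n^'n \<Rightarrow> bool" where
  "neg_def_mat M \<longleftrightarrow> transpose M = M \<and> (\<forall>v. v \<noteq> 0 \<longrightarrow> v \<bullet> (M *v v) < 0)"

(* "z has derivative v on [0, oo)", with the one-sided derivative at 0.  Exceptional
   times, finitely many in each bounded interval, are allowed (z stays continuous there), so that
   piecewise continuous inputs are covered; classical solutions are the case S = {}. *)
definition evolves_by :: "(real \<Rightarrow> 'a::real_normed_vector) \<Rightarrow> (real \<Rightarrow> 'a) \<Rightarrow> bool" where
  "evolves_by z v \<longleftrightarrow>
     continuous_on {0..} z \<and>
     (\<exists>S. (\<forall>T. finite (S \<inter> {0..T})) \<and> (\<forall>t\<in>{0..} - S. (z has_vector_derivative v t) (at t within {0..})))"

(* The values of x and u at negative times are the initial history; they are unrestricted. *)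
definition plant_solution ::
  "real^'n^'n \<Rightarrow> real^'n^'n \<Rightarrow> nat \<Rightarrow> (nat \<Rightarrow> real) \<Rightarrow> (nat \<Rightarrow> real) \<Rightarrow>
   nat \<Rightarrow> (nat \<Rightarrow> real^'m^'n) \<Rightarrow> (nat \<Rightarrow> real) \<Rightarrow>
   (real \<Rightarrow> real^'m) \<Rightarrow> (real \<Rightarrow> real^'n) \<Rightarrow> bool" where
  "plant_solution A Ad mx a \<tau> mu B \<delta> u x \<longleftrightarrow>
     evolves_by x (\<lambda>t. A *v x t
       + (\<Sum>i=1..mx. a i *\<^sub>R (Ad *v x (t - \<tau> i)))
       + (\<Sum>j=1..mu. B j *v u (t - \<delta> j)))"

(* e = x - xhat, where xhat = w + E y and y = C x *)
definition estimation_error ::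
  "real^'n^'p \<Rightarrow> real^'p^'n \<Rightarrow> (real \<Rightarrow> real^'n) \<Rightarrow> (real \<Rightarrow> real^'n) \<Rightarrow> real \<Rightarrow> real^'n" where
  "estimation_error C E x w t = x t - (w t + E *v (C *v x t))"

definition cubic_gain :: "real^'n^'p \<Rightarrow> real^'p^'p \<Rightarrow> real^'n \<Rightarrow> real" where
  "cubic_gain C \<theta> v = v \<bullet> ((transpose C ** \<theta> ** C) *v v)"

definition cubic_observer_solution ::
  "real^'n^'p \<Rightarrow> nat \<Rightarrow> (nat \<Rightarrow> real) \<Rightarrow> nat \<Rightarrow> (nat \<Rightarrow> real) \<Rightarrow>
   real^'n^'n \<Rightarrow> real^'p^'n \<Rightarrow> (nat \<Rightarrow> real^'p^'n) \<Rightarrow> (nat \<Rightarrow> real^'m^'n) \<Rightarrow>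
   real^'p^'n \<Rightarrow> real^'p^'n \<Rightarrow> real^'p^'p \<Rightarrow>
   (real \<Rightarrow> real^'m) \<Rightarrow> (real \<Rightarrow> real^'n) \<Rightarrow> (real \<Rightarrow> real^'n) \<Rightarrow> bool" where
  "cubic_observer_solution C mx \<tau> mu \<delta> G J Jd H E N \<theta> u x w \<longleftrightarrow>
     evolves_by w (\<lambda>t. G *v w t
       + J *v (C *v x t)
       + (\<Sum>i=1..mx. Jd i *v (C *v x (t - \<tau> i)))
       + (\<Sum>j=1..mu. H j *v u (t - \<delta> j))
       - cubic_gain C \<theta> (estimation_error C E x w t)
           *\<^sub>R ((N ** C) *v estimation_error C E x w t))"

(* Global asymptotic stability of the zero trajectory within a family F of trajectories on
   [0, oo): Lyapunov stability together with convergence to 0 from arbitrary initial values. *)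
definition globally_asymp_stable :: "(real \<Rightarrow> 'a::real_normed_vector) set \<Rightarrow> bool" where
  "globally_asymp_stable F \<longleftrightarrow>
     (\<forall>\<epsilon>>0. \<exists>r>0. \<forall>e\<in>F. norm (e 0) < r \<longrightarrow> (\<forall>t\<ge>0. norm (e t) < \<epsilon>)) \<and>
     (\<forall>e\<in>F. (e \<longlongrightarrow> 0) at_top)"

(* The first conjunct says that the error dynamics has no finite escape time: along every plant
   trajectory the observer runs on all of [0, oo) from any initial state, hence from any
   initial error.  The second one is stability of all resulting errors, uniformly in the
   plant trajectory and the input. *)
definition error_dynamics_globally_stable ::
  "real^'n^'n \<Rightarrow> real^'n^'n \<Rightarrow> nat \<Rightarrow> (nat \<Rightarrow> real) \<Rightarrow> (nat \<Rightarrow> real) \<Rightarrow>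
   nat \<Rightarrow> (nat \<Rightarrow> real^'m^'n) \<Rightarrow> (nat \<Rightarrow> real) \<Rightarrow> real^'n^'p \<Rightarrow>
   real^'n^'n \<Rightarrow> real^'p^'n \<Rightarrow> (nat \<Rightarrow> real^'p^'n) \<Rightarrow> (nat \<Rightarrow> real^'m^'n) \<Rightarrow>
   real^'p^'n \<Rightarrow> real^'p^'n \<Rightarrow> real^'p^'p \<Rightarrow> bool" where
  "error_dynamics_globally_stable A Ad mx a \<tau> mu B \<delta> C G J Jd H E N \<theta> \<longleftrightarrow>
     (\<forall>u x w0. plant_solution A Ad mx a \<tau> mu B \<delta> u x \<longrightarrow>
        (\<exists>w. w 0 = w0 \<and> cubic_observer_solution C mx \<tau> mu \<delta> G J Jd H E N \<theta> u x w)) \<and>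
     globally_asymp_stable
       {estimation_error C E x w | u x w.
          plant_solution A Ad mx a \<tau> mu B \<delta> u x \<and>
          cubic_observer_solution C mx \<tau> mu \<delta> G J Jd H E N \<theta> u x w}"

end

theory Submission
  imports Defs
begin

text \<open>Multiply the plant equation by \<open>I - E C\<close> and subtract the observer equation. By the matching
conditions the state, the delayed states and the inputs cancel
(\<open>matched_observer_cancellation\<close>), and the error obeys the autonomous, delay-free equation
\<open>e' = G e + q(e) N C e\<close> with \<open>q(e) = e\<^sup>T C\<^sup>T \<theta> C e \<ge> 0\<close>.

For \<open>V(e) = e\<^sup>T P e\<close> the linear part contributes \<open>e\<^sup>T (G\<^sup>T P + P G) e\<close> to \<open>V'\<close>, which is at most
\<open>- 2 \<nu> V\<close> for some \<open>\<nu> > 0\<close>. The cubic part contributes \<open>q(e) e\<^sup>T (P N C + C\<^sup>T N\<^sup>T P) e \<le> 0\<close>. Hence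
\<open>|e t| \<le> K exp (- \<nu> t) |e 0|\<close> with \<open>K\<close> depending on \<open>P\<close> only (\<open>error_field_dissipative\<close>,
\<open>exponential_estimate\<close>). This gives Lyapunov stability and convergence, uniformly in the plant
trajectory and the input. The estimate is obtained by integration, since the trajectories may fail to
be differentiable at isolated times.

It remains to see that the observer runs for all times. The observer state is \<open>(I - E C) x - e\<close>, so
it suffices to solve the error equation on \<open>[0, \<infinity>)\<close>. Its right-hand side is only locally Lipschitz;
cut off outside a large ball, it is globally Lipschitz and has a global solution by Picard iteration
(\<open>lipschitz_ode_global_solution\<close>), and as the cut-off preserves the sign of \<open>V'\<close>, this solution never
leaves the ball (\<open>dissipative_ode_global_solution\<close>).\<close>

section \<open>Quadratic forms\<close>

text \<open>Both sides are homogeneous of degree two, so \<open>c\<close> can be the minimum over the unit sphere, which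
is attained by compactness.\<close>

lemma pos_quadratic_form_coercive:
  fixes M :: "real^'n^'n"
  assumes pos: "\<And>v. v \<noteq> 0 \<Longrightarrow> 0 < v \<bullet> (M *v v)"
  obtains c where "0 < c" and "\<And>v. c * (norm v)\<^sup>2 \<le> v \<bullet> (M *v v)"
proof -
  let ?S = "sphere (0::real^'n) 1"
  obtain b :: "real^'n" where "b \<in> Basis" using nonempty_Basis by blast
  then have "?S \<noteq> {}" by (metis dist_0_norm empty_iff mem_sphere norm_Basis)
  moreover have "continuous_on ?S (\<lambda>v. v \<bullet> (M *v v))"
    by (intro continuous_on_inner continuous_on_id linear_continuous_on matrix_vector_mul_bounded_linear)
  ultimately obtain s where s: "s \<in> ?S" and min: "\<And>v. v \<in> ?S \<Longrightarrow> s \<bullet> (M *v s) \<le> v \<bullet> (M *v v)"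
    using continuous_attains_inf[OF compact_sphere] by blast
  let ?c = "s \<bullet> (M *v s)"
  have "?c * (norm v)\<^sup>2 \<le> v \<bullet> (M *v v)" for v
  proof (cases "v = 0")
    case False
    then have "?c \<le> (v /\<^sub>R norm v) \<bullet> (M *v (v /\<^sub>R norm v))" by (intro min) simp
    also have "\<dots> = (v \<bullet> (M *v v)) / (norm v)\<^sup>2"
      by (simp add: matrix_vector_mult_scaleR power2_eq_square divide_inverse)
    finally show ?thesis using False by (simp add: pos_le_divide_eq)
  qed simp
  moreover have "0 < ?c" using s by (intro pos) auto
  ultimately show thesis using that by blast
qed

lemma quadratic_form_bounded:
  fixes M :: "real^'n^'n"
  obtains p where "0 < p" and "\<And>v. v \<bullet> (M *v v) \<le> p * (norm v)\<^sup>2"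
proof -
  obtain p where p: "0 < p" "\<And>v. norm (M *v v) \<le> norm v * p"
    using bounded_linear.pos_bounded[OF matrix_vector_mul_bounded_linear] by metis
  have "v \<bullet> (M *v v) \<le> p * (norm v)\<^sup>2" for v
    using norm_cauchy_schwarz[of v "M *v v"] mult_left_mono[OF p(2) norm_ge_zero, of v v]
    by (simp add: power2_eq_square algebra_simps)
  with p(1) show thesis using that by blast
qed

lemma inner_matrix_commute:
  fixes P :: "real^'n^'n"
  assumes "transpose P = P"
  shows "v \<bullet> (P *v w) = w \<bullet> (P *v v)"
  by (metis assms dot_lmul_matrix inner_commute vector_transpose_matrix)

text \<open>The matrix \<open>M\<^sup>T P + P M\<close> represents the derivative of the quadratic form of \<open>P\<close> along the
linear vector field \<open>M\<close>.\<close>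

lemma lyapunov_quadratic_form:
  fixes M P :: "real^'n^'n"
  assumes "transpose P = P"
  shows "v \<bullet> ((transpose M ** P + P ** M) *v v) = 2 * (v \<bullet> (P *v (M *v v)))"
proof -
  have "v \<bullet> (transpose M *v (P *v v)) = (M *v v) \<bullet> (P *v v)"
    by (metis dot_lmul_matrix inner_commute vector_transpose_matrix)
  also have "\<dots> = v \<bullet> (P *v (M *v v))" by (rule inner_matrix_commute[OF assms])
  finally show ?thesis
    by (simp add: matrix_vector_mult_add_rdistrib inner_add_right flip: matrix_vector_mul_assoc)
qed

section \<open>Lyapunov estimates\<close>

text \<open>At a time where only continuity is known the derivative may be replaced by any value, because
finitely many points do not change the integral in the fundamental theorem of calculus.\<close>

lemma nonincreasing_if_derivative_nonpos_off_finite: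
  fixes \<phi> :: "real \<Rightarrow> real"
  assumes cont: "continuous_on {0..} \<phi>"
    and fin: "\<And>T. finite (S \<inter> {0..T})"
    and deriv: "\<And>t. t \<in> {0..} - S \<Longrightarrow> (\<phi> has_vector_derivative \<phi>' t) (at t within {0..})"
    and nonpos: "\<And>t. t \<in> {0..} - S \<Longrightarrow> \<phi>' t \<le> 0"
    and "0 \<le> T"
  shows "\<phi> T \<le> \<phi> 0"
proof -
  let ?D = "\<lambda>t. if t \<in> S then 0 else \<phi>' t"
  have "(?D has_integral \<phi> T - \<phi> 0) {0..T}"
  proof (rule fundamental_theorem_of_calculus_interior_strong[OF fin[of T] \<open>0 \<le> T\<close>])
    fix t assume t: "t \<in> {0<..<T} - S \<inter> {0..T}"
    then have "(\<phi> has_vector_derivative \<phi>' t) (at t within {0..})" by (intro deriv) auto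
    moreover have "at t within {0..} = at t" using t by (intro at_within_interior) auto
    ultimately show "(\<phi> has_vector_derivative ?D t) (at t)" using t by auto
  qed (use cont continuous_on_subset in fastforce)
  then have "\<phi> T - \<phi> 0 \<le> 0"
    by (rule has_integral_le[OF _ has_integral_0]) (use nonpos in auto)
  then show ?thesis by simp
qed

text \<open>Along a solution \<open>V = e \<bullet> P e\<close> satisfies \<open>V' \<le> - 2 \<nu> V\<close>, so \<open>exp (2 \<nu> t) V\<close> does not
increase.\<close>

lemma quadratic_lyapunov_decay:
  fixes P :: "real^'n^'n" and f :: "real^'n \<Rightarrow> real^'n"
  assumes sym: "transpose P = P"
    and diss: "\<And>v. v \<bullet> (P *v f v) \<le> - \<nu> * (v \<bullet> (P *v v))"
    and evo: "evolves_by e (\<lambda>t. f (e t))"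
    and "0 \<le> T"
  shows "e T \<bullet> (P *v e T) \<le> exp (- 2 * \<nu> * T) * (e 0 \<bullet> (P *v e 0))"
proof -
  obtain S where cont: "continuous_on {0..} e" and fin: "\<And>T. finite (S \<inter> {0..T})"
    and deriv: "\<And>t. t \<in> {0..} - S \<Longrightarrow> (e has_vector_derivative f (e t)) (at t within {0..})"
    using evo unfolding evolves_by_def by blast
  let ?V = "\<lambda>t. e t \<bullet> (P *v e t)"
  let ?\<phi> = "\<lambda>t. exp (2 * \<nu> * t) * ?V t"
  let ?d = "\<lambda>t. exp (2 * \<nu> * t) * (2 * (e t \<bullet> (P *v f (e t))) + 2 * \<nu> * ?V t)"
  have "?\<phi> T \<le> ?\<phi> 0"
  proof (rule nonincreasing_if_derivative_nonpos_off_finite[OF _ fin _ _ \<open>0 \<le> T\<close>])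
    have "continuous_on {0..} (\<lambda>t. P *v e t)"
      by (rule bounded_linear.continuous_on[OF matrix_vector_mul_bounded_linear cont])
    then show "continuous_on {0..} ?\<phi>" by (intro continuous_intros cont)
  next
    fix t assume t: "t \<in> {0..} - S"
    have "(?V has_vector_derivative (e t \<bullet> (P *v f (e t)) + f (e t) \<bullet> (P *v e t))) (at t within {0..})"
      by (intro bounded_bilinear.has_vector_derivative[OF bounded_bilinear_inner]
          bounded_linear.has_vector_derivative[OF matrix_vector_mul_bounded_linear] deriv t)
    then have V: "(?V has_vector_derivative 2 * (e t \<bullet> (P *v f (e t)))) (at t within {0..})"
      by (simp add: inner_matrix_commute[OF sym, of "f (e t)"])
    have "((\<lambda>t. exp (2 * \<nu> * t)) has_vector_derivative 2 * \<nu> * exp (2 * \<nu> * t)) (at t within {0..})"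
      unfolding has_real_derivative_iff_has_vector_derivative[symmetric]
      by (auto intro!: derivative_eq_intros)
    from bounded_bilinear.has_vector_derivative[OF bounded_bilinear_mult this V]
    show "(?\<phi> has_vector_derivative ?d t) (at t within {0..})"
      by (rule has_vector_derivative_eq_rhs) (simp add: distrib_left mult_ac)
    show "?d t \<le> 0"
      using diss[of "e t"] by (simp add: mult_le_0_iff)
  qed
  then have "exp (- 2 * \<nu> * T) * ?\<phi> T \<le> exp (- 2 * \<nu> * T) * ?\<phi> 0"
    by (intro mult_left_mono) auto
  then have "(exp (- 2 * \<nu> * T) * exp (2 * \<nu> * T)) * ?V T \<le> exp (- 2 * \<nu> * T) * ?V 0"
    by (simp only: mult.assoc) simp
  then show ?thesis by (simp add: exp_minus_inverse mult.commute)
qed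

text \<open>The constant depends on \<open>P\<close> only, which makes the estimate uniform in the solution and in the
vector field. The case \<open>\<nu> = 0\<close> is the a priori bound used for global existence.\<close>

lemma exponential_estimate:
  fixes P :: "real^'n^'n"
  assumes P: "pos_def_mat P"
  obtains K where "0 < K"
    and "\<And>f \<nu> e t. (\<And>v. v \<bullet> (P *v f v) \<le> - \<nu> * (v \<bullet> (P *v v))) \<Longrightarrow> evolves_by e (\<lambda>t. f (e t))
           \<Longrightarrow> 0 \<le> t \<Longrightarrow> norm (e t) \<le> K * exp (- \<nu> * t) * norm (e 0)"
proof -
  have sym: "transpose P = P" using P by (simp add: pos_def_mat_def)
  obtain c where c: "0 < c" "\<And>v. c * (norm v)\<^sup>2 \<le> v \<bullet> (P *v v)"
    using pos_quadratic_form_coercive[of P] P unfolding pos_def_mat_def by metis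
  obtain p where p: "0 < p" "\<And>v. v \<bullet> (P *v v) \<le> p * (norm v)\<^sup>2"
    using quadratic_form_bounded by blast
  show thesis
  proof (rule that)
    show "0 < sqrt (p / c)" using c p by simp
    fix f :: "real^'n \<Rightarrow> real^'n" and \<nu> e and t :: real
    assume diss: "\<And>v. v \<bullet> (P *v f v) \<le> - \<nu> * (v \<bullet> (P *v v))"
      and evo: "evolves_by e (\<lambda>t. f (e t))" and "0 \<le> t"
    have "c * (norm (e t))\<^sup>2 \<le> exp (- 2 * \<nu> * t) * (e 0 \<bullet> (P *v e 0))"
      by (rule order_trans[OF c(2) quadratic_lyapunov_decay[OF sym diss evo \<open>0 \<le> t\<close>]])
    also have "\<dots> \<le> exp (- 2 * \<nu> * t) * (p * (norm (e 0))\<^sup>2)"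
      by (intro mult_left_mono p(2)) auto
    finally have "(norm (e t))\<^sup>2 \<le> p / c * exp (- 2 * \<nu> * t) * (norm (e 0))\<^sup>2"
      using c(1) by (simp add: pos_le_divide_eq mult_ac)
    also have "\<dots> = (sqrt (p / c) * exp (- \<nu> * t) * norm (e 0))\<^sup>2"
      using c p exp_double[of "- \<nu> * t"] by (simp add: power_mult_distrib mult.assoc)
    finally show "norm (e t) \<le> sqrt (p / c) * exp (- \<nu> * t) * norm (e 0)"
      by (rule power2_le_imp_le) (use c p in auto)
  qed
qed

section \<open>Global existence for differential equations\<close>

lemma indefinite_integral_has_vector_derivative:
  fixes h :: "real \<Rightarrow> 'a::banach"
  assumes "continuous_on {0..} h" and "0 \<le> t"
  shows "((\<lambda>t. integral {0..t} h) has_vector_derivative h t) (at t within {0..})"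
proof -
  have "((\<lambda>t. integral {0..t} h) has_vector_derivative h t) (at t within {0..t+1})"
    using assms by (intro integral_has_vector_derivative) (auto intro: continuous_on_subset)
  moreover have "at t within {0..} = at t within {0..t+1}"
    by (rule at_within_nhd[of t "{..<t+1}"]) auto
  ultimately show ?thesis by simp
qed

lemma norm_integral_le_exp:
  fixes h :: "real \<Rightarrow> 'a::banach"
  assumes "0 < k" "0 \<le> t" "continuous_on {0..} h"
    and le: "\<And>s. 0 \<le> s \<Longrightarrow> norm (h s) \<le> c * exp (k * s)"
  shows "norm (integral {0..t} h) \<le> c / k * exp (k * t)"
proof -
  have int: "((\<lambda>s. c * exp (k * s)) has_integral c / k * exp (k * t) - c / k * exp (k * 0)) {0..t}"
    using \<open>0 < k\<close> \<open>0 \<le> t\<close>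
    by (intro fundamental_theorem_of_calculus)
       (auto intro!: derivative_eq_intros simp flip: has_real_derivative_iff_has_vector_derivative)
  have "h integrable_on {0..t}"
    using assms(3) by (intro integrable_continuous_real) (auto intro: continuous_on_subset)
  then have "norm (integral {0..t} h) \<le> integral {0..t} (\<lambda>s. c * exp (k * s))"
    using has_integral_integrable[OF int] by (rule integral_norm_bound_integral) (simp add: le)
  then have "norm (integral {0..t} h) \<le> c / k * exp (k * t) - c / k * exp (k * 0)"
    by (simp only: integral_unique[OF int])
  moreover have "0 \<le> c / k" using order_trans[OF norm_ge_zero le[of 0]] \<open>0 < k\<close> by simp
  ultimately show ?thesis by simp
qed

text \<open>A Picard iteration that reaches all of \<open>[0, \<infinity>)\<close> at once: in the norm
\<open>sup exp (- k t) |e t - e0|\<close> with \<open>k > L\<close> the integral operator contracts by \<open>L / k\<close>. The unknown is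
the weighted difference \<open>g t = exp (- k t) (e t - e0)\<close>, a bounded continuous function, continued
constantly to negative times.\<close>

lemma lipschitz_ode_global_solution:
  fixes f :: "'a::banach \<Rightarrow> 'a"
  assumes lip: "L-lipschitz_on UNIV f"
  obtains e where "e 0 = e0"
    and "\<And>t. 0 \<le> t \<Longrightarrow> (e has_vector_derivative f (e t)) (at t within {0..})"
proof -
  define k where "k = L + 1"
  have L: "0 \<le> L" and k: "0 < k" "L < k" using lipschitz_on_nonneg[OF lip] by (auto simp: k_def)
  define h where "h g s = f (e0 + exp (k * s) *\<^sub>R apply_bcontfun g s)" for g :: "real \<Rightarrow>\<^sub>C 'a" and s
  have f_cont: "continuous_on X f" for X
    using lipschitz_on_continuous_on[OF lip] continuous_on_subset by blast
  have h_cont: "continuous_on X (h g)" for X g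
    unfolding h_def by (intro continuous_on_compose2[OF f_cont[of UNIV]] continuous_intros) auto
  have h_bound: "norm (h g s) \<le> (norm (f e0) + L * norm g) * exp (k * s)" if "0 \<le> s" for g s
  proof -
    have "norm (h g s) \<le> norm (f e0) + norm (h g s - f e0)" by (rule norm_triangle_sub)
    also have "norm (h g s - f e0) \<le> L * norm (exp (k * s) *\<^sub>R apply_bcontfun g s)"
      unfolding h_def
      using lipschitz_on_normD[OF lip, of "e0 + exp (k * s) *\<^sub>R apply_bcontfun g s" e0] by simp
    also have "\<dots> \<le> L * (exp (k * s) * norm g)"
      using L norm_bounded[of g s] by (auto intro!: mult_left_mono)
    also have "norm (f e0) \<le> norm (f e0) * exp (k * s)"
      using that k by (simp add: mult_le_cancel_left1)
    finally show ?thesis by (simp add: algebra_simps)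
  qed
  have h_diff: "norm (h g s - h g' s) \<le> L * dist g g' * exp (k * s)" for g g' s
  proof -
    have "norm (h g s - h g' s) \<le> L * norm (exp (k * s) *\<^sub>R (apply_bcontfun g s - apply_bcontfun g' s))"
      unfolding h_def using lipschitz_on_normD[OF lip, of "e0 + exp (k * s) *\<^sub>R apply_bcontfun g s"
          "e0 + exp (k * s) *\<^sub>R apply_bcontfun g' s"] by (simp add: algebra_simps)
    also have "\<dots> \<le> L * (exp (k * s) * dist g g')"
      using L dist_bounded[of g s g'] by (auto intro!: mult_left_mono simp: dist_norm)
    finally show ?thesis by (simp add: algebra_simps)
  qed
  define \<Psi> where "\<Psi> g t = exp (- k * max 0 t) *\<^sub>R integral {0..max 0 t} (h g)" for g t
  have weight: "norm (exp (- k * t) *\<^sub>R x) \<le> b" if "norm x \<le> b * exp (k * t)" for t b and x :: 'a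
    using that by (simp add: exp_minus field_simps)
  have \<Psi>_bcontfun: "\<Psi> g \<in> bcontfun" for g
  proof (rule bcontfun_normI)
    have "continuous_on {0..} (\<lambda>t. integral {0..t} (h g))"
      unfolding continuous_on_eq_continuous_within
      using indefinite_integral_has_vector_derivative[OF h_cont, of _ g]
      by (meson atLeast_iff has_vector_derivative_continuous)
    then have "continuous_on UNIV (\<lambda>t. integral {0..max 0 t} (h g))"
      by (rule continuous_on_compose2) (auto intro!: continuous_intros)
    then show "continuous_on UNIV (\<Psi> g)" unfolding \<Psi>_def by (intro continuous_intros)
    show "norm (\<Psi> g t) \<le> (norm (f e0) + L * norm g) / k" for t
      unfolding \<Psi>_def by (intro weight norm_integral_le_exp k h_cont h_bound) auto
  qed
  define \<Phi> where "\<Phi> g = Bcontfun (\<Psi> g)" for g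
  have \<Phi>: "apply_bcontfun (\<Phi> g) = \<Psi> g" for g
    unfolding \<Phi>_def by (rule Bcontfun_inverse[OF \<Psi>_bcontfun])
  have "dist (\<Phi> g) (\<Phi> g') \<le> L / k * dist g g'" for g g'
  proof (rule dist_bound)
    fix t
    have int: "h g'' integrable_on {0..max 0 t}" for g''
      by (intro integrable_continuous_real h_cont)
    have "norm (exp (- k * max 0 t) *\<^sub>R integral {0..max 0 t} (\<lambda>s. h g s - h g' s)) \<le> L * dist g g' / k"
      by (intro weight norm_integral_le_exp k continuous_on_diff h_cont h_diff) auto
    also have "integral {0..max 0 t} (\<lambda>s. h g s - h g' s)
        = integral {0..max 0 t} (h g) - integral {0..max 0 t} (h g')"
      by (intro integral_diff int)
    finally show "dist (apply_bcontfun (\<Phi> g) t) (apply_bcontfun (\<Phi> g') t) \<le> L / k * dist g g'"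
      unfolding \<Phi> \<Psi>_def by (simp add: dist_norm scaleR_diff_right)
  qed
  then have "\<exists>!g. \<Phi> g = g"
    using L k by (intro banach_fix_type[of "L / k"]) auto
  then obtain g where g: "\<Phi> g = g" by blast
  define e where "e t = e0 + exp (k * t) *\<^sub>R apply_bcontfun g t" for t
  have h_g: "h g = (\<lambda>s. f (e s))" by (simp add: fun_eq_iff h_def e_def)
  have e: "e t = e0 + integral {0..t} (h g)" if "0 \<le> t" for t
  proof -
    have "apply_bcontfun g t = exp (- k * t) *\<^sub>R integral {0..t} (h g)"
      using that arg_cong[OF g, of "\<lambda>g. apply_bcontfun g t"] unfolding \<Phi> \<Psi>_def by simp
    then show ?thesis by (simp add: e_def flip: exp_add)
  qed
  show thesis
  proof (rule that)
    show "e 0 = e0" using e[of 0] by simp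
    fix t :: real assume "0 \<le> t"
    then have "((\<lambda>t. e0 + integral {0..t} (h g)) has_vector_derivative f (e t)) (at t within {0..})"
      using has_vector_derivative_add[OF has_vector_derivative_const
          indefinite_integral_has_vector_derivative[OF h_cont, of t g]]
      unfolding h_g by simp
    then show "(e has_vector_derivative f (e t)) (at t within {0..})"
      by (rule has_vector_derivative_transform[rotated 2]) (use e \<open>0 \<le> t\<close> in auto)
  qed
qed

text \<open>A product of Lipschitz functions is Lipschitz where both factors are bounded, which is what
compactness provides.\<close>

lemma (in bounded_bilinear) lipschitz_on_compact:
  assumes X: "compact X" and f: "L-lipschitz_on X f" and g: "M-lipschitz_on X g"
  obtains D where "D-lipschitz_on X (\<lambda>x. prod (f x) (g x))"
proof -
  obtain B where B: "0 < B" "\<And>a b. norm (prod a b) \<le> norm a * norm b * B"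
    using pos_bounded by blast
  obtain b where b: "\<And>x. x \<in> X \<Longrightarrow> norm (f x) \<le> b" "\<And>x. x \<in> X \<Longrightarrow> norm (g x) \<le> b" "0 \<le> b"
  proof -
    obtain b1 b2 where "\<And>x. x \<in> X \<Longrightarrow> norm (f x) \<le> b1" "\<And>x. x \<in> X \<Longrightarrow> norm (g x) \<le> b2"
      using compact_imp_bounded[OF compact_continuous_image[OF lipschitz_on_continuous_on[OF f] X]]
        compact_imp_bounded[OF compact_continuous_image[OF lipschitz_on_continuous_on[OF g] X]]
      unfolding bounded_iff by blast
    then show thesis by (intro that[of "max 0 (max b1 b2)"]) (auto simp: le_max_iff_disj)
  qed
  have nonneg: "0 \<le> L" "0 \<le> M" using f g lipschitz_on_nonneg by auto
  have "(B * b * (L + M))-lipschitz_on X (\<lambda>x. prod (f x) (g x))"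
  proof (rule lipschitz_onI)
    fix x y assume xy: "x \<in> X" "y \<in> X"
    have "prod (f x) (g x) - prod (f y) (g y) = prod (f x - f y) (g x) + prod (f y) (g x - g y)"
      by (simp add: diff_left diff_right)
    then have "norm (prod (f x) (g x) - prod (f y) (g y))
        \<le> norm (f x - f y) * norm (g x) * B + norm (f y) * norm (g x - g y) * B"
      by (metis B(2) add_mono norm_triangle_le)
    also have "\<dots> \<le> (L * dist x y) * b * B + b * (M * dist x y) * B"
      using xy B(1) b nonneg lipschitz_onD[OF f xy] lipschitz_onD[OF g xy]
      by (intro add_mono mult_right_mono mult_mono) (auto simp: dist_norm)
    finally show "dist (prod (f x) (g x)) (prod (f y) (g y)) \<le> B * b * (L + M) * dist x y"
      by (simp add: dist_norm algebra_simps)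
  qed (use B b nonneg in simp)
  then show thesis by (rule that)
qed

text \<open>This direction, from the projection back to the vector, is the one that transfers a sign
condition on \<open>v \<bullet> P (f v)\<close>: replacing the first \<open>v\<close> by its projection costs a nonnegative factor.\<close>

lemma closest_point_cball_radial:
  fixes v :: "'a::euclidean_space"
  assumes "0 < R"
  obtains s where "0 \<le> s" and "v = s *\<^sub>R closest_point (cball 0 R) v"
proof (cases "norm v \<le> R")
  case True
  then show thesis using that[of 1] closest_point_self[of v "cball 0 R"] by simp
next
  case False
  let ?w = "(R / norm v) *\<^sub>R v"
  have "?w = closest_point (cball 0 R) v"
  proof (rule closest_point_unique)
    show "?w \<in> cball 0 R" using False \<open>0 < R\<close> by (simp add: dist_norm)
    have "dist v ?w = norm v - R"
    proof -
      have "v - ?w = (1 - R / norm v) *\<^sub>R v" by (simp add: scaleR_diff_left)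
      moreover have "\<bar>1 - R / norm v\<bar> = 1 - R / norm v"
        using False \<open>0 < R\<close> by (intro abs_of_nonneg) (simp add: divide_le_eq)
      moreover have "norm v \<noteq> 0" using False \<open>0 < R\<close> by linarith
      ultimately show ?thesis by (simp add: dist_norm left_diff_distrib)
    qed
    moreover have "norm v - R \<le> dist v z" if "z \<in> cball 0 R" for z
      using norm_triangle_ineq2[of v z] that by (simp add: dist_norm)
    ultimately show "\<forall>z\<in>cball 0 R. dist v ?w \<le> dist v z" by simp
  qed auto
  moreover have "v = (norm v / R) *\<^sub>R ?w" using False \<open>0 < R\<close> by auto
  ultimately show thesis using that[of "norm v / R"] \<open>0 < R\<close> by simp
qed

text \<open>Lipschitz bounds on balls alone do not exclude escape in finite time.
Composing the vector field with the projection onto a large ball makes it globally Lipschitz.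
The projection only rescales vectors, so the modified field still does not increase the quadratic
form of \<open>P\<close>; hence its solution stays in the ball, where the two fields agree.\<close>

lemma dissipative_ode_global_solution:
  fixes f :: "real^'n \<Rightarrow> real^'n"
  assumes P: "pos_def_mat P"
    and lip: "\<And>R. \<exists>L. L-lipschitz_on (cball 0 R) f"
    and diss: "\<And>v. v \<bullet> (P *v f v) \<le> 0"
  obtains e where "e 0 = e0" and "evolves_by e (\<lambda>t. f (e t))"
proof -
  obtain K where K: "0 < K"
    "\<And>f \<nu> e t. (\<And>v. v \<bullet> (P *v f v) \<le> - \<nu> * (v \<bullet> (P *v v))) \<Longrightarrow> evolves_by e (\<lambda>t. f (e t))
       \<Longrightarrow> 0 \<le> t \<Longrightarrow> norm (e t) \<le> K * exp (- \<nu> * t) * norm (e 0)"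
    using exponential_estimate[OF P] by blast
  \<comment> \<open>\<open>K * norm e0\<close> is the a priori bound on the solution; the summand makes \<open>R\<close> positive.\<close>
  define R where "R = K * norm e0 + 1"
  have R: "0 < R" using K(1) by (simp add: R_def add_nonneg_pos)
  define \<rho> where "\<rho> = closest_point (cball (0::real^'n) R)"
  have \<rho>_in: "\<rho> v \<in> cball 0 R" for v
    unfolding \<rho>_def using R by (intro closest_point_in_set) auto
  obtain L where "L-lipschitz_on (cball 0 R) f" using lip by blast
  moreover have "1-lipschitz_on UNIV \<rho>"
    unfolding \<rho>_def using R by (auto intro!: lipschitz_onI closest_point_lipschitz)
  ultimately have "(L * 1)-lipschitz_on UNIV (\<lambda>v. f (\<rho> v))"
    using \<rho>_in by (intro lipschitz_on_compose2) (auto intro: lipschitz_on_subset)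
  then obtain e where e0: "e 0 = e0"
    and deriv: "\<And>t. 0 \<le> t \<Longrightarrow> (e has_vector_derivative f (\<rho> (e t))) (at t within {0..})"
    using lipschitz_ode_global_solution[where ?e0.0 = e0] by metis
  have cont: "continuous_on {0..} e"
    unfolding continuous_on_eq_continuous_within
    using deriv has_vector_derivative_continuous by (metis atLeast_iff)
  have "v \<bullet> (P *v f (\<rho> v)) \<le> 0" for v
  proof -
    obtain s where "0 \<le> s" "v = s *\<^sub>R \<rho> v"
      unfolding \<rho>_def using closest_point_cball_radial[OF R] by blast
    then have "v \<bullet> (P *v f (\<rho> v)) = s * (\<rho> v \<bullet> (P *v f (\<rho> v)))" by (metis inner_scaleR_left)
    then show ?thesis using diss[of "\<rho> v"] \<open>0 \<le> s\<close> by (simp add: mult_nonneg_nonpos)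
  qed
  moreover have "evolves_by e (\<lambda>t. f (\<rho> (e t)))"
    unfolding evolves_by_def using cont deriv by (auto intro!: exI[of _ "{}"])
  ultimately have "norm (e t) \<le> K * norm e0" if "0 \<le> t" for t
    using K(2)[of "\<lambda>v. f (\<rho> v)" 0 e t] that e0 by simp
  then have "\<rho> (e t) = e t" if "0 \<le> t" for t
    unfolding \<rho>_def using that by (intro closest_point_self) (force simp: R_def)
  then have "evolves_by e (\<lambda>t. f (e t))"
    unfolding evolves_by_def using cont deriv by (auto intro!: exI[of _ "{}"])
  with e0 show thesis by (rule that)
qed

section \<open>The error dynamics\<close>

definition error_field ::
  "real^'n^'n \<Rightarrow> real^'p^'n \<Rightarrow> real^'n^'p \<Rightarrow> real^'p^'p \<Rightarrow> real^'n \<Rightarrow> real^'n" where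
  "error_field G N C \<theta> v = G *v v + cubic_gain C \<theta> v *\<^sub>R ((N ** C) *v v)"

lemma error_field_lipschitz:
  "\<exists>L. L-lipschitz_on (cball 0 R) (error_field G N C \<theta>)"
proof -
  let ?X = "cball (0::real^'n) R"
  have lin: "\<exists>L. L-lipschitz_on ?X ((*v) M)" for M :: "real^'n^'n"
    using bounded_linear.lipschitz_boundE[OF matrix_vector_mul_bounded_linear] by metis
  obtain L1 L2 L3 where L: "L1-lipschitz_on ?X ((*v) G)"
    "L2-lipschitz_on ?X ((*v) (transpose C ** \<theta> ** C))" "L3-lipschitz_on ?X ((*v) (N ** C))"
    using lin by metis
  obtain D where "D-lipschitz_on ?X (cubic_gain C \<theta>)"
    using bounded_bilinear.lipschitz_on_compact
      [OF bounded_bilinear_inner compact_cball lipschitz_on_id L(2)]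
    unfolding cubic_gain_def by blast
  then obtain D' where "D'-lipschitz_on ?X (\<lambda>v. cubic_gain C \<theta> v *\<^sub>R ((N ** C) *v v))"
    using bounded_bilinear.lipschitz_on_compact[OF bounded_bilinear_scaleR compact_cball _ L(3)]
    by blast
  from lipschitz_on_add[OF L(1) this] show ?thesis unfolding error_field_def by blast
qed

lemma cubic_gain_nonneg:
  assumes "pos_semidef_mat \<theta>"
  shows "0 \<le> cubic_gain C \<theta> v"
proof -
  have "cubic_gain C \<theta> v = (C *v v) \<bullet> (\<theta> *v (C *v v))"
    unfolding cubic_gain_def
    by (metis dot_lmul_matrix matrix_vector_mul_assoc vector_transpose_matrix)
  then show ?thesis using assms by (simp add: pos_semidef_mat_def)
qed

text \<open>Since the gain is nonnegative, the cubic term can only help; the linear term alone gives the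
decay rate.\<close>

lemma error_field_dissipative:
  fixes G P :: "real^'n^'n" and C :: "real^'n^'p"
  assumes \<theta>: "pos_semidef_mat \<theta>" and P: "pos_def_mat P"
    and G: "neg_def_mat (transpose G ** P + P ** G)"
    and N: "neg_def_mat (P ** N ** C + transpose C ** transpose N ** P)"
  obtains \<nu> where "0 < \<nu>"
    and "\<And>v. v \<bullet> (P *v error_field G N C \<theta> v) \<le> - \<nu> * (v \<bullet> (P *v v))"
proof -
  have sym: "transpose P = P" using P by (simp add: pos_def_mat_def)
  have form_G: "v \<bullet> ((0 - (transpose G ** P + P ** G)) *v v) = - 2 * (v \<bullet> (P *v (G *v v)))" for v
    using lyapunov_quadratic_form[OF sym, of v G]
    unfolding matrix_vector_mult_diff_rdistrib inner_diff_right by simp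
  obtain c where c: "0 < c" "\<And>v. c * (norm v)\<^sup>2 \<le> - 2 * (v \<bullet> (P *v (G *v v)))"
    using pos_quadratic_form_coercive[of "0 - (transpose G ** P + P ** G)"] G
    unfolding form_G neg_def_mat_def lyapunov_quadratic_form[OF sym] by (auto simp: mult_less_0_iff)
  obtain p where p: "0 < p" "\<And>v. v \<bullet> (P *v v) \<le> p * (norm v)\<^sup>2"
    using quadratic_form_bounded by blast
  have form_N: "v \<bullet> ((P ** N ** C + transpose C ** transpose N ** P) *v v)
      = 2 * (v \<bullet> (P *v ((N ** C) *v v)))" for v
    using lyapunov_quadratic_form[OF sym, of v "N ** C"]
    by (simp add: matrix_transpose_mul matrix_mul_assoc add.commute)
  show thesis
  proof (rule that)
    show "0 < c / (2 * p)" using c p by simp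
    fix v
    have "v \<bullet> (P *v ((N ** C) *v v)) \<le> 0"
      using N unfolding neg_def_mat_def form_N by (cases "v = 0") (auto simp: less_imp_le mult_less_0_iff)
    then have "v \<bullet> (P *v error_field G N C \<theta> v) \<le> v \<bullet> (P *v (G *v v))"
      using cubic_gain_nonneg[OF \<theta>, of C v]
      by (simp add: error_field_def matrix_vector_right_distrib matrix_vector_mult_scaleR
          inner_add_right mult_nonneg_nonpos)
    also have "\<dots> \<le> - (c / 2) * (norm v)\<^sup>2" using c(2)[of v] by simp
    also have "\<dots> \<le> - (c / (2 * p)) * (v \<bullet> (P *v v))"
      using mult_left_mono[OF p(2)[of v], of "c / (2 * p)"] c(1) p(1) by simp
    finally show "v \<bullet> (P *v error_field G N C \<theta> v) \<le> - (c / (2 * p)) * (v \<bullet> (P *v v))" .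
  qed
qed

lemma evolves_by_matrix:
  fixes M :: "real^'n^'m"
  assumes "evolves_by x f"
  shows "evolves_by (\<lambda>t. M *v x t) (\<lambda>t. M *v f t)"
proof -
  have "continuous_on {0..} x \<Longrightarrow> continuous_on {0..} (\<lambda>t. M *v x t)"
    by (rule bounded_linear.continuous_on[OF matrix_vector_mul_bounded_linear])
  moreover have "((\<lambda>t. M *v x t) has_vector_derivative M *v f t) (at t within {0..})"
    if "(x has_vector_derivative f t) (at t within {0..})" for t
    by (rule bounded_linear.has_vector_derivative[OF matrix_vector_mul_bounded_linear that])
  ultimately show ?thesis using assms unfolding evolves_by_def by blast
qed

lemma evolves_by_diff:
  assumes "evolves_by x f" and "evolves_by y g"
  shows "evolves_by (\<lambda>t. x t - y t) (\<lambda>t. f t - g t)"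
proof -
  obtain S T where "\<And>b. finite (S \<inter> {0..b})" "\<And>b. finite (T \<inter> {0..b})"
    and deriv: "\<And>t. t \<in> {0..} - S \<Longrightarrow> (x has_vector_derivative f t) (at t within {0..})"
      "\<And>t. t \<in> {0..} - T \<Longrightarrow> (y has_vector_derivative g t) (at t within {0..})"
    using assms unfolding evolves_by_def by meson
  then have "finite ((S \<union> T) \<inter> {0..b})" for b by (simp add: Int_Un_distrib2)
  moreover have "((\<lambda>t. x t - y t) has_vector_derivative f t - g t) (at t within {0..})"
    if "t \<in> {0..} - (S \<union> T)" for t
    using that by (intro has_vector_derivative_diff deriv) auto
  moreover have "continuous_on {0..} (\<lambda>t. x t - y t)"
    using assms unfolding evolves_by_def by (intro continuous_on_diff) auto
  ultimately show ?thesis unfolding evolves_by_def by blast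
qed

text \<open>The matching conditions make the state, its delayed values and the input cancel from the
difference between the plant equation, multiplied by \<open>I - E C\<close>, and the observer equation.\<close>

lemma matched_observer_cancellation:
  fixes A Ad G :: "real^'n^'n" and C :: "real^'n^'p" and B H :: "nat \<Rightarrow> real^'m^'n"
    and J E N :: "real^'p^'n" and Jd :: "nat \<Rightarrow> real^'p^'n"
  defines "M \<equiv> mat 1 - E ** C"
  assumes A: "G ** M + J ** C - M ** A = 0"
    and B: "\<forall>j\<in>{1..mu}. M ** B j - H j = 0"
    and Ad: "\<forall>i\<in>{1..mx}. M ** (a i *\<^sub>R Ad) - Jd i ** C = 0"
    and w: "w = M *v x - e"
  shows "M *v (A *v x + (\<Sum>i=1..mx. a i *\<^sub>R (Ad *v xd i)) + (\<Sum>j=1..mu. B j *v ud j))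
    = error_field G N C \<theta> e
      + (G *v w + J *v (C *v x) + (\<Sum>i=1..mx. Jd i *v (C *v xd i)) + (\<Sum>j=1..mu. H j *v ud j)
         - cubic_gain C \<theta> e *\<^sub>R ((N ** C) *v e))"
proof -
  have "M *v (A *v x) = G *v (M *v x) + J *v (C *v x)"
    using A by (simp add: matrix_vector_mul_assoc flip: matrix_vector_mult_add_rdistrib)
  moreover have "M *v (\<Sum>i=1..mx. a i *\<^sub>R (Ad *v xd i)) = (\<Sum>i=1..mx. Jd i *v (C *v xd i))"
  proof -
    have "M *v (a i *\<^sub>R (Ad *v xd i)) = Jd i *v (C *v xd i)" if "i \<in> {1..mx}" for i
      using Ad that by (simp add: matrix_vector_mul_assoc scaleR_matrix_vector_assoc)
    then show ?thesis by (simp add: linear_sum[OF matrix_vector_mul_linear])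
  qed
  moreover have "M *v (\<Sum>j=1..mu. B j *v ud j) = (\<Sum>j=1..mu. H j *v ud j)"
    using B by (simp add: linear_sum[OF matrix_vector_mul_linear] matrix_vector_mul_assoc)
  ultimately show ?thesis
    by (simp add: w error_field_def matrix_vector_right_distrib matrix_vector_mult_diff_distrib)
qed

lemma estimation_error_eq:
  "estimation_error C E x w t = (mat 1 - E ** C) *v x t - w t"
  by (simp add: estimation_error_def matrix_vector_mult_diff_rdistrib matrix_vector_mul_assoc)

theorem theorem5:
  fixes A Ad G :: "real^'n^'n"
    and C :: "real^'n^'p"
    and B H :: "nat \<Rightarrow> real^'m^'n"
    and J E N :: "real^'p^'n"
    and Jd :: "nat \<Rightarrow> real^'p^'n"
    and \<theta> :: "real^'p^'p"
    and mx mu :: nat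
    and a \<tau> \<delta> :: "nat \<Rightarrow> real"
  assumes "\<forall>i\<in>{1..mx}. \<tau> i > 0"
    and "\<forall>j\<in>{1..mu}. \<delta> j \<ge> 0"
    and "pos_semidef_mat \<theta>"
    and "\<not> (\<exists>v. v \<noteq> 0 \<and> G *v v + cubic_gain C \<theta> v *\<^sub>R ((N ** C) *v v) = 0)"
    and "\<exists>P. pos_def_mat P \<and> neg_def_mat (transpose G ** P + P ** G)
           \<and> neg_def_mat (P ** N ** C + transpose C ** transpose N ** P)"
    and "G ** (mat 1 - E ** C) + J ** C - (mat 1 - E ** C) ** A = 0"
    and "\<forall>j\<in>{1..mu}. (mat 1 - E ** C) ** B j - H j = 0"
    and "\<forall>i\<in>{1..mx}. (mat 1 - E ** C) ** (a i *\<^sub>R Ad) - Jd i ** C = 0"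
  shows "error_dynamics_globally_stable A Ad mx a \<tau> mu B \<delta> C G J Jd H E N \<theta>"
proof -
  let ?M = "mat 1 - E ** C" and ?F = "error_field G N C \<theta>"
  let ?plant = "plant_solution A Ad mx a \<tau> mu B \<delta>"
    and ?observer = "cubic_observer_solution C mx \<tau> mu \<delta> G J Jd H E N \<theta>"
  obtain P where P: "pos_def_mat P" and G: "neg_def_mat (transpose G ** P + P ** G)"
    and N: "neg_def_mat (P ** N ** C + transpose C ** transpose N ** P)"
    using assms(5) by blast
  obtain \<nu> where \<nu>: "0 < \<nu>" and diss: "\<And>v. v \<bullet> (P *v ?F v) \<le> - \<nu> * (v \<bullet> (P *v v))"
    using error_field_dissipative[OF assms(3) P G N] by blast
  obtain K where "0 < K" and K: "\<And>f \<nu> e t. (\<And>v. v \<bullet> (P *v f v) \<le> - \<nu> * (v \<bullet> (P *v v)))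
      \<Longrightarrow> evolves_by e (\<lambda>t. f (e t)) \<Longrightarrow> 0 \<le> t \<Longrightarrow> norm (e t) \<le> K * exp (- \<nu> * t) * norm (e 0)"
    using exponential_estimate[OF P] by blast
  note cancellation = matched_observer_cancellation[OF assms(6-8), where N = N and \<theta> = \<theta>]

  have existence: "\<exists>w. w 0 = w0 \<and> ?observer u x w" if x: "?plant u x" for u x w0
  proof -
    have "v \<bullet> (P *v ?F v) \<le> 0" for v
    proof -
      have "0 \<le> v \<bullet> (P *v v)" using P by (cases "v = 0") (auto simp: pos_def_mat_def less_imp_le)
      then have "- \<nu> * (v \<bullet> (P *v v)) \<le> 0" using \<nu> by simp
      with diss[of v] show ?thesis by (rule order_trans)
    qed
    then obtain e where e0: "e 0 = ?M *v x 0 - w0" and e: "evolves_by e (\<lambda>t. ?F (e t))"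
      using dissipative_ode_global_solution[OF P error_field_lipschitz] by metis
    \<comment> \<open>The observer state is determined by the plant state and the error.\<close>
    define w where "w t = ?M *v x t - e t" for t
    have "estimation_error C E x w = e" by (simp add: fun_eq_iff estimation_error_eq w_def)
    then have "?observer u x w"
      using evolves_by_diff[OF evolves_by_matrix[OF x[unfolded plant_solution_def], of ?M] e]
      unfolding cancellation[OF w_def] cubic_observer_solution_def
      by (simp flip: w_def)
    moreover have "w 0 = w0" by (simp add: w_def e0)
    ultimately show ?thesis by blast
  qed
  have decay: "norm (e t) \<le> K * exp (- \<nu> * t) * norm (e 0)"
    if e: "e \<in> {estimation_error C E x w | u x w. ?plant u x \<and> ?observer u x w}" and "0 \<le> t" for e t
  proof -
    obtain u x w where x: "?plant u x" and w: "?observer u x w" and e_eq: "e = estimation_error C E x w"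
      using e by blast
    have w_eq: "w t = ?M *v x t - e t" for t by (simp add: e_eq estimation_error_eq)
    have "evolves_by e (\<lambda>t. ?F (e t))"
      using evolves_by_diff[OF evolves_by_matrix[OF x[unfolded plant_solution_def], of ?M]
          w[unfolded cubic_observer_solution_def, folded e_eq]]
      unfolding cancellation[OF w_eq] by (simp add: w_eq)
    from K[OF diss this \<open>0 \<le> t\<close>] show ?thesis .
  qed
  have "globally_asymp_stable {estimation_error C E x w | u x w. ?plant u x \<and> ?observer u x w}"
    (is "globally_asymp_stable ?errors")
    unfolding globally_asymp_stable_def
  proof (intro conjI allI impI ballI)
    fix \<epsilon> :: real assume "0 < \<epsilon>"
    have "norm (e t) < \<epsilon>" if "e \<in> ?errors" "norm (e 0) < \<epsilon> / K" "0 \<le> t" for e t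
    proof -
      have "norm (e t) \<le> K * exp (- \<nu> * t) * norm (e 0)" by (rule decay[OF that(1,3)])
      also have "\<dots> \<le> K * 1 * norm (e 0)"
        using \<nu> \<open>0 < K\<close> that(3) by (intro mult_right_mono mult_left_mono) auto
      also have "\<dots> < \<epsilon>" using that(2) \<open>0 < K\<close> by (simp add: field_simps)
      finally show ?thesis .
    qed
    then show "\<exists>r>0. \<forall>e\<in>?errors. norm (e 0) < r \<longrightarrow> (\<forall>t\<ge>0. norm (e t) < \<epsilon>)"
      using \<open>0 < \<epsilon>\<close> \<open>0 < K\<close> by (intro exI[of _ "\<epsilon> / K"]) simp
  next
    fix e assume e: "e \<in> ?errors"
    have "filterlim (\<lambda>t. - \<nu> * t) at_bot at_top"
      using \<nu> by (intro filterlim_tendsto_neg_mult_at_bot[OF tendsto_const _ filterlim_ident]) simp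
    then have "((\<lambda>t. exp (- \<nu> * t)) \<longlongrightarrow> 0) at_top"
      by (rule filterlim_compose[OF exp_at_bot])
    then have "((\<lambda>t. K * exp (- \<nu> * t) * norm (e 0)) \<longlongrightarrow> K * 0 * norm (e 0)) at_top"
      by (intro tendsto_intros)
    then have "((\<lambda>t. K * exp (- \<nu> * t) * norm (e 0)) \<longlongrightarrow> 0) at_top" by simp
    moreover have "\<forall>\<^sub>F t in at_top. norm (e t) \<le> K * exp (- \<nu> * t) * norm (e 0)"
      using decay[OF e] by (rule eventually_at_top_linorderI[of 0])
    ultimately show "(e \<longlongrightarrow> 0) at_top" by (rule Lim_null_comparison[rotated])
  qed
  then show ?thesis using existence unfolding error_dynamics_globally_stable_def by blast
qed

end
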